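(* Let $\Gamma$ be a residually connected incidence geometry over $I=\{0,\dots,n-1\}$, $n\ge3$, satisfying $(B_1)$ and $(B_2)$ for the pair $\{0,1\}$ and such that $\Gamma[0,1]$ is not bipartite. Then the incidence system $\mathcal{P}(\Gamma)(0,1)$ is an incidence geometry, i.e. every flag of it is contained in a chamber.
   Context: Standard notions: incidence system/geometry $(X,I,*,t)$, flags, chambers (flags with one element of each type), residues $\Gamma_x$, truncation $\Gamma[J]$, $S_i=t^{-1}(i)$, $\sigma_0(x)$ the set of $0$-elements incident to $x$. $(B_1)$: $\Gamma[0,1]$ is the geometry of a simple graph (vertices = $0$-elements, edges = $1$-elements; each edge has exactly two vertices; two vertices lie on at most one common edge); $p\sim q$ denotes adjacency. $(B_2)$: for an edge $e$ and $x$ of type $\notin\{0,1\}$, $e*x$ iff $\sigma_0(e)\subseteq\sigma_0(x)$. For a connected graph $\mathcal{G}$ on $V$, $\pi(\mathcal{G})$ is the set of classes of "joined by an even walk" ($\{V\}$ if non-bipartite, the two colour classes if bipartite); $\bar P=V\setminus P$ if bipartite, $\bar P=P$ otherwise. $\mathcal{P}(\Gamma)(0,1)$: elements of type $0$ are $(p,0)$, of type $1$ are $(p,1)$, $p\in S_0$; of type $i\ge2$ are $(x,P_x)$ with $x\in S_i$, $P_x\in\pi(\Gamma_x[0,1])$. Incidence of distinct types: $(x,P_x)*'(y,P_y)$ iff $x*y$ and $P_x\cap P_y\ne\emptyset$; $(p,0)*'(y,P_y)$ iff $p*y$ and $p\in P_y$; $(q,1)*'(y,P_y)$ iff $q*y$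 and $q\in\bar P_y$; $(p,0)*'(q,1)$ iff $p\sim q$. *)

theory Defs
  imports Main
begin

record ('a, 'i) inc_struct =
  elts :: "'a set"
  types :: "'i set"
  inc :: "'a \<Rightarrow> 'a \<Rightarrow> bool"
  ty :: "'a \<Rightarrow> 'i"

text \<open>The values of \<open>inc\<close> and \<open>ty\<close> outside the carrier are irrelevant; every
  definition below quantifies over the carrier only.\<close>

definition incidence_system :: "('a, 'i) inc_struct \<Rightarrow> bool" where
  "incidence_system \<Gamma> \<longleftrightarrow>
     ty \<Gamma> ` elts \<Gamma> \<subseteq> types \<Gamma> \<and>
     reflp_on (elts \<Gamma>) (inc \<Gamma>) \<and> symp_on (elts \<Gamma>) (inc \<Gamma>) \<and>
     (\<forall>x\<in>elts \<Gamma>. \<forall>y\<in>elts \<Gamma>. inc \<Gamma> x y \<and> ty \<Gamma> x = ty \<Gamma> y \<longrightarrow> x = y)"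

definition flag :: "('a, 'i) inc_struct \<Rightarrow> 'a set \<Rightarrow> bool" where
  "flag \<Gamma> F \<longleftrightarrow> F \<subseteq> elts \<Gamma> \<and> (\<forall>x\<in>F. \<forall>y\<in>F. inc \<Gamma> x y)"

definition chamber :: "('a, 'i) inc_struct \<Rightarrow> 'a set \<Rightarrow> bool" where
  "chamber \<Gamma> C \<longleftrightarrow> flag \<Gamma> C \<and> (\<forall>i\<in>types \<Gamma>. \<exists>!x. x \<in> C \<and> ty \<Gamma> x = i)"

definition incidence_geometry :: "('a, 'i) inc_struct \<Rightarrow> bool" where
  "incidence_geometry \<Gamma> \<longleftrightarrow>
     incidence_system \<Gamma> \<and> (\<forall>F. flag \<Gamma> F \<longrightarrow> (\<exists>C. chamber \<Gamma> C \<and> F \<subseteq> C))"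

definition residue :: "('a, 'i) inc_struct \<Rightarrow> 'a set \<Rightarrow> ('a, 'i) inc_struct" where
  "residue \<Gamma> F =
     \<lparr>elts = {y \<in> elts \<Gamma>. y \<notin> F \<and> (\<forall>x\<in>F. inc \<Gamma> y x)},
      types = types \<Gamma> - ty \<Gamma> ` F, inc = inc \<Gamma>, ty = ty \<Gamma>\<rparr>"

definition truncation :: "('a, 'i) inc_struct \<Rightarrow> 'i set \<Rightarrow> ('a, 'i) inc_struct" where
  "truncation \<Gamma> J =
     \<lparr>elts = {x \<in> elts \<Gamma>. ty \<Gamma> x \<in> J}, types = J, inc = inc \<Gamma>, ty = ty \<Gamma>\<rparr>"

definition elts_of_type :: "('a, 'i) inc_struct \<Rightarrow> 'i \<Rightarrow> 'a set" where
  "elts_of_type \<Gamma> i = {x \<in> elts \<Gamma>. ty \<Gamma> x = i}"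

definition shadow0 :: "('a, nat) inc_struct \<Rightarrow> 'a \<Rightarrow> 'a set" where
  "shadow0 \<Gamma> x = {p \<in> elts_of_type \<Gamma> 0. inc \<Gamma> p x}"


text \<open>Graphs are given by a vertex set \<open>V\<close> and an adjacency predicate \<open>E\<close>.\<close>

definition graph_connected :: "'v set \<Rightarrow> ('v \<Rightarrow> 'v \<Rightarrow> bool) \<Rightarrow> bool" where
  "graph_connected V E \<longleftrightarrow>
     V \<noteq> {} \<and> (\<forall>u\<in>V. \<forall>v\<in>V. (\<lambda>a b. a \<in> V \<and> b \<in> V \<and> E a b)\<^sup>*\<^sup>* u v)"

definition graph_bipartite :: "'v set \<Rightarrow> ('v \<Rightarrow> 'v \<Rightarrow> bool) \<Rightarrow> bool" where
  "graph_bipartite V E \<longleftrightarrow>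
     (\<exists>A\<subseteq>V. \<forall>u\<in>V. \<forall>v\<in>V. E u v \<longrightarrow> (u \<in> A \<longleftrightarrow> v \<notin> A))"

definition even_walk_rel :: "'v set \<Rightarrow> ('v \<Rightarrow> 'v \<Rightarrow> bool) \<Rightarrow> ('v \<times> 'v) set" where
  "even_walk_rel V E =
     {(u, v). u \<in> V \<and> v \<in> V \<and> (\<exists>k. ((\<lambda>a b. a \<in> V \<and> b \<in> V \<and> E a b) ^^ (2 * k)) u v)}"

definition even_classes :: "'v set \<Rightarrow> ('v \<Rightarrow> 'v \<Rightarrow> bool) \<Rightarrow> 'v set set" where
  "even_classes V E = V // even_walk_rel V E"

definition opposite_class :: "'v set \<Rightarrow> ('v \<Rightarrow> 'v \<Rightarrow> bool) \<Rightarrow> 'v set \<Rightarrow> 'v set" where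
  "opposite_class V E P = (if graph_bipartite V E then V - P else P)"


definition residually_connected :: "('a, 'i) inc_struct \<Rightarrow> bool" where
  "residually_connected \<Gamma> \<longleftrightarrow>
     (\<forall>F. flag \<Gamma> F \<and> card (types (residue \<Gamma> F)) \<ge> 2 \<longrightarrow>
        graph_connected (elts (residue \<Gamma> F))
          (\<lambda>x y. x \<noteq> y \<and> inc (residue \<Gamma> F) x y))"

text \<open>The graph underlying a system over the types 0 and 1: its vertices are the 0-elements, and
  two distinct vertices are adjacent iff they lie on a common 1-element.\<close>

abbreviation verts :: "('a, nat) inc_struct \<Rightarrow> 'a set" where
  "verts \<Delta> \<equiv> elts_of_type \<Delta> 0"

definition adj :: "('a, nat) inc_struct \<Rightarrow> 'a \<Rightarrow> 'a \<Rightarrow> bool" where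
  "adj \<Delta> p q \<longleftrightarrow> p \<in> verts \<Delta> \<and> q \<in> verts \<Delta> \<and> p \<noteq> q \<and>
     (\<exists>e\<in>elts_of_type \<Delta> 1. inc \<Delta> p e \<and> inc \<Delta> q e)"

definition B1 :: "('a, nat) inc_struct \<Rightarrow> bool" where
  "B1 \<Gamma> \<longleftrightarrow>
     (\<forall>e\<in>elts_of_type \<Gamma> 1. card (shadow0 \<Gamma> e) = 2) \<and>
     (\<forall>p\<in>elts_of_type \<Gamma> 0. \<forall>q\<in>elts_of_type \<Gamma> 0. p \<noteq> q \<longrightarrow>
        (\<forall>e\<in>elts_of_type \<Gamma> 1. \<forall>f\<in>elts_of_type \<Gamma> 1.
           inc \<Gamma> p e \<and> inc \<Gamma> q e \<and> inc \<Gamma> p f \<and> inc \<Gamma> q f \<longrightarrow> e = f))"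

definition B2 :: "('a, nat) inc_struct \<Rightarrow> bool" where
  "B2 \<Gamma> \<longleftrightarrow>
     (\<forall>e\<in>elts_of_type \<Gamma> 1. \<forall>x\<in>elts \<Gamma>. ty \<Gamma> x \<notin> {0, 1} \<longrightarrow>
        (inc \<Gamma> e x \<longleftrightarrow> shadow0 \<Gamma> e \<subseteq> shadow0 \<Gamma> x))"

abbreviation res01 :: "('a, nat) inc_struct \<Rightarrow> 'a \<Rightarrow> ('a, nat) inc_struct" where
  "res01 \<Gamma> x \<equiv> truncation (residue \<Gamma> {x}) {0, 1}"

definition parity_classes :: "('a, nat) inc_struct \<Rightarrow> 'a \<Rightarrow> 'a set set" where
  "parity_classes \<Gamma> x = even_classes (verts (res01 \<Gamma> x)) (adj (res01 \<Gamma> x))"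

definition parity_opposite :: "('a, nat) inc_struct \<Rightarrow> 'a \<Rightarrow> 'a set \<Rightarrow> 'a set" where
  "parity_opposite \<Gamma> x P = opposite_class (verts (res01 \<Gamma> x)) (adj (res01 \<Gamma> x)) P"


text \<open>\<open>PZero p\<close>, \<open>POne p\<close> and \<open>PHigh x P\<close> stand for the pairs
  $(p,0)$, $(p,1)$ and $(x,P)$.\<close>

datatype 'a pelt = PZero 'a | POne 'a | PHigh 'a "'a set"

fun ptyp :: "('a, nat) inc_struct \<Rightarrow> 'a pelt \<Rightarrow> nat" where
  "ptyp \<Gamma> (PZero p) = 0"
| "ptyp \<Gamma> (POne p) = 1"
| "ptyp \<Gamma> (PHigh x P) = ty \<Gamma> x"

text \<open>Between elements of equal type incidence is equality, as in any incidence system.\<close>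

fun pinc :: "('a, nat) inc_struct \<Rightarrow> 'a pelt \<Rightarrow> 'a pelt \<Rightarrow> bool" where
  "pinc \<Gamma> (PZero p) (PZero q) \<longleftrightarrow> p = q"
| "pinc \<Gamma> (POne p) (POne q) \<longleftrightarrow> p = q"
| "pinc \<Gamma> (PZero p) (POne q) \<longleftrightarrow> adj (truncation \<Gamma> {0, 1}) p q"
| "pinc \<Gamma> (POne q) (PZero p) \<longleftrightarrow> adj (truncation \<Gamma> {0, 1}) p q"
| "pinc \<Gamma> (PZero p) (PHigh y P) \<longleftrightarrow> inc \<Gamma> p y \<and> p \<in> P"
| "pinc \<Gamma> (PHigh y P) (PZero p) \<longleftrightarrow> inc \<Gamma> p y \<and> p \<in> P"
| "pinc \<Gamma> (POne q) (PHigh y P) \<longleftrightarrow> inc \<Gamma> q y \<and> q \<in> parity_opposite \<Gamma> y P"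
| "pinc \<Gamma> (PHigh y P) (POne q) \<longleftrightarrow> inc \<Gamma> q y \<and> q \<in> parity_opposite \<Gamma> y P"
| "pinc \<Gamma> (PHigh x P) (PHigh y Q) \<longleftrightarrow>
     (if ty \<Gamma> x = ty \<Gamma> y then x = y \<and> P = Q else inc \<Gamma> x y \<and> P \<inter> Q \<noteq> {})"

definition parity_system :: "('a, nat) inc_struct \<Rightarrow> ('a pelt, nat) inc_struct" where
  "parity_system \<Gamma> =
     \<lparr>elts = PZero ` elts_of_type \<Gamma> 0 \<union> POne ` elts_of_type \<Gamma> 0 \<union>
        {PHigh x P | x P. x \<in> elts \<Gamma> \<and> ty \<Gamma> x \<ge> 2 \<and> P \<in> parity_classes \<Gamma> x},
      types = types \<Gamma>, inc = pinc \<Gamma>, ty = ptyp \<Gamma>\<rparr>"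

end

theory Submission
  imports Defs
begin

text \<open>By \<open>(B\<^sub>1)\<close> and \<open>(B\<^sub>2)\<close>, for a flag \<open>F\<close> without elements of type 0 or 1 the graph of the residue
  of \<open>F\<close> is the subgraph of the graph of \<open>\<Gamma>\<close> induced on the common shadow of \<open>F\<close>, and residual
  connectedness makes it connected. If \<open>(x,P)\<close> and \<open>(y,Q)\<close> are incident and the graph of \<open>x\<close> is
  bipartite, then \<open>P\<close> and \<open>Q\<close> meet the common shadow of \<open>x\<close> and \<open>y\<close> consistently: a walk in it
  between two vertices of \<open>P\<close> is even, hence stays in the class \<open>Q\<close>. So pairwise
  intersecting classes of a flag have a common vertex \<open>p\<close>, which has a neighbour \<open>q\<close> in the
  common shadow. A chamber of \<open>\<Gamma>\<close> through the edge \<open>pq\<close> then lifts to a chamber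
  containing \<open>(p,0)\<close>, \<open>(q,1)\<close> and the given flag, every \<open>x\<close> taking the class of \<open>p\<close>.\<close>

section \<open>Walks of even length\<close>

abbreviation walk_step :: "'v set \<Rightarrow> ('v \<Rightarrow> 'v \<Rightarrow> bool) \<Rightarrow> 'v \<Rightarrow> 'v \<Rightarrow> bool" where
  "walk_step V E \<equiv> \<lambda>a b. a \<in> V \<and> b \<in> V \<and> E a b"

lemma relpowp_sym:
  assumes "\<And>a b. R a b \<Longrightarrow> R b a" and "(R ^^ k) a b"
  shows "(R ^^ k) b a"
  using assms(2)
proof (induction k arbitrary: b)
  case (Suc k)
  then obtain c where "(R ^^ k) a c" "R c b" by auto
  then show ?case
    using Suc.IH assms(1) by (metis relpowp_Suc_I2)
qed simp

text \<open>Each step changes sides, so the sides of the two ends fix the parity of the length. One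
  walk of known parity thus decides the parity of all walks between its ends.\<close>

lemma walk_bipartition:
  assumes A: "\<forall>u\<in>V. \<forall>v\<in>V. E u v \<longrightarrow> (u \<in> A \<longleftrightarrow> v \<notin> A)"
    and "(walk_step V E ^^ k) u v"
  shows "(u \<in> A \<longleftrightarrow> v \<in> A) \<longleftrightarrow> even k"
  using assms(2)
proof (induction k arbitrary: v)
  case (Suc k)
  then obtain w where "(walk_step V E ^^ k) u w" "w \<in> V" "v \<in> V" "E w v" by auto
  then show ?case using Suc.IH[of w] A by auto
qed simp

lemma even_walk_relI:
  assumes "u \<in> V" "v \<in> V" "(walk_step V E ^^ k) u v" "even k"
  shows "(u, v) \<in> even_walk_rel V E"
  using assms by (auto simp: even_walk_rel_def elim!: evenE)

lemma equiv_even_walk_rel: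
  assumes "\<And>a b. E a b \<Longrightarrow> E b a"
  shows "equiv V (even_walk_rel V E)"
proof (rule equivI)
  show "even_walk_rel V E \<subseteq> V \<times> V" by (auto simp: even_walk_rel_def)
  show "refl_on V (even_walk_rel V E)"
    by (auto simp: refl_on_def even_walk_rel_def intro!: exI[of _ 0])
  show "sym (even_walk_rel V E)"
  proof (rule symI)
    fix u v assume "(u, v) \<in> even_walk_rel V E"
    then obtain k where "u \<in> V" "v \<in> V" and k: "(walk_step V E ^^ (2 * k)) u v"
      by (auto simp: even_walk_rel_def)
    have "(walk_step V E ^^ (2 * k)) v u"
      by (rule relpowp_sym[OF _ k]) (auto intro: assms)
    then show "(v, u) \<in> even_walk_rel V E"
      using \<open>u \<in> V\<close> \<open>v \<in> V\<close> by (auto simp: even_walk_rel_def)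
  qed
  show "trans (even_walk_rel V E)"
  proof (rule transI)
    fix u v w assume "(u, v) \<in> even_walk_rel V E" "(v, w) \<in> even_walk_rel V E"
    then obtain k l where V: "u \<in> V" "w \<in> V"
      and "(walk_step V E ^^ (2 * k)) u v" "(walk_step V E ^^ (2 * l)) v w"
      by (auto simp: even_walk_rel_def)
    then have "(walk_step V E ^^ (2 * k + 2 * l)) u w"
      by (auto simp: relpowp_add)
    then show "(u, w) \<in> even_walk_rel V E" by (rule even_walk_relI[OF V]) simp
  qed
qed

text \<open>If some vertex is not reached from \<open>u\<close> by an even walk, then there is no odd closed walk at \<open>u\<close>,
  so the vertices reached by even walks form a colour class.\<close>

lemma even_walk_rel_nonbipartite:
  assumes sym: "\<And>a b. E a b \<Longrightarrow> E b a"
    and conn: "\<And>u v. u \<in> V \<Longrightarrow> v \<in> V \<Longrightarrow> (walk_step V E)\<^sup>*\<^sup>* u v"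
    and nb: "\<not> graph_bipartite V E" and u: "u \<in> V" and v: "v \<in> V"
  shows "(u, v) \<in> even_walk_rel V E"
proof (rule ccontr)
  assume n: "(u, v) \<notin> even_walk_rel V E"
  let ?R = "walk_step V E"
  have walk: "\<exists>k. (?R ^^ k) u w" if "w \<in> V" for w
    using conn[OF u that] by (simp add: rtranclp_power)
  have no_odd: "even k" if "(?R ^^ k) u u" for k
  proof (rule ccontr)
    assume "odd k"
    obtain l where l: "(?R ^^ l) u v" using walk[OF v] by blast
    have "odd l" using n even_walk_relI[OF u v l] by blast
    \<comment> \<open>Running through the odd closed walk first turns an odd walk from
      \<open>u\<close> to \<open>v\<close> into an even one.\<close>
    have "(?R ^^ (k + l)) u v" using that l by (auto simp: relpowp_add)
    then show False using n even_walk_relI[OF u v, of "k + l" E] \<open>odd k\<close> \<open>odd l\<close> by simp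
  qed
  have "a \<in> even_walk_rel V E `` {u} \<longleftrightarrow> b \<notin> even_walk_rel V E `` {u}"
    if ab: "a \<in> V" "b \<in> V" "E a b" for a b
  proof -
    obtain k where k: "(?R ^^ k) u a" using walk[OF ab(1)] by blast
    have kb: "(?R ^^ Suc k) u b" using k ab by auto
    \<comment> \<open>One walk followed by the reverse of the other is closed at \<open>u\<close>,
      hence even: the parity of the distance travelled from \<open>u\<close> depends on the end
      alone.\<close>
    have same: "even i \<longleftrightarrow> even j" if "(?R ^^ i) u w" "(?R ^^ j) u w" for i j w
    proof -
      have "(?R ^^ j) w u" by (rule relpowp_sym[OF _ that(2)]) (auto intro: sym)
      then have "(?R ^^ (i + j)) u u" using that by (auto simp: relpowp_add)
      from no_odd[OF this] show ?thesis by simp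
    qed
    have "(u, a) \<in> even_walk_rel V E \<longleftrightarrow> even k"
      using even_walk_relI[OF u ab(1) k] by (auto simp: even_walk_rel_def dest: same[OF k])
    moreover have "(u, b) \<in> even_walk_rel V E \<longleftrightarrow> even (Suc k)"
      using even_walk_relI[OF u ab(2) kb] by (auto simp: even_walk_rel_def dest: same[OF kb])
    ultimately show ?thesis by simp
  qed
  then have "graph_bipartite V E"
    unfolding graph_bipartite_def
    by (intro exI[of _ "even_walk_rel V E `` {u}"]) (auto simp: even_walk_rel_def)
  with nb show False by simp
qed

text \<open>In the bipartite case the even classes are the two colours, and an edge joins different
  colours; otherwise \<open>P\<close> and its opposite are both all of \<open>V\<close>. This links
  the incidence conditions for the elements of types 0 and 1.\<close>

lemma opposite_class_adjacent:
  assumes sym: "\<And>a b. E a b \<Longrightarrow> E b a"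
    and conn: "\<And>u v. u \<in> V \<Longrightarrow> v \<in> V \<Longrightarrow> (walk_step V E)\<^sup>*\<^sup>* u v"
    and P: "P \<in> even_classes V E"
    and pq: "p \<in> V" "q \<in> V" "E p q"
  shows "q \<in> opposite_class V E P \<longleftrightarrow> p \<in> P"
proof -
  note eq = equiv_even_walk_rel[of E V, OF sym]
  obtain w where w: "w \<in> V" and P_eq: "P = even_walk_rel V E `` {w}"
    using P by (auto simp: even_classes_def quotient_def)
  show ?thesis
  proof (cases "graph_bipartite V E")
    case True
    then obtain A where A: "\<forall>u\<in>V. \<forall>v\<in>V. E u v \<longrightarrow> (u \<in> A \<longleftrightarrow> v \<notin> A)"
      unfolding graph_bipartite_def by (elim exE conjE) (rule that)
    \<comment> \<open>Connectedness supplies some walk from \<open>w\<close> to \<open>v\<close>,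
      and the colours of its ends decide its parity.\<close>
    have "(w, v) \<in> even_walk_rel V E \<longleftrightarrow> (w \<in> A \<longleftrightarrow> v \<in> A)" if v: "v \<in> V" for v
    proof -
      obtain k where k: "(walk_step V E ^^ k) w v"
        using conn[OF w v] by (auto simp: rtranclp_power)
      show ?thesis
        using walk_bipartition[OF A k] even_walk_relI[OF w v k]
        by (auto simp: even_walk_rel_def dest: walk_bipartition[OF A])
    qed
    then show ?thesis using True pq A by (auto simp: opposite_class_def P_eq)
  next
    case False
    then show ?thesis
      using even_walk_rel_nonbipartite[OF sym conn False w] pq
      by (auto simp: opposite_class_def P_eq)
  qed
qed

section \<open>Graphs of residues\<close>

text \<open>For empty \<open>F\<close> this is the whole vertex set, so flags without elements of
  type at least 2 need no separate treatment.\<close>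

definition common_shadow :: "('a, nat) inc_struct \<Rightarrow> 'a set \<Rightarrow> 'a set" where
  "common_shadow \<Gamma> F = {p \<in> elts_of_type \<Gamma> 0. \<forall>x\<in>F. inc \<Gamma> p x}"

lemma common_shadow_singleton: "common_shadow \<Gamma> {x} = shadow0 \<Gamma> x"
  by (simp add: common_shadow_def shadow0_def)

lemma adj_sym: "adj \<Gamma> p q \<Longrightarrow> adj \<Gamma> q p"
  by (auto simp: adj_def)

lemma adj_truncation: "adj (truncation \<Gamma> {0, 1}) = adj \<Gamma>"
  by (auto simp: adj_def truncation_def elts_of_type_def fun_eq_iff)

lemma flagD: "flag \<Gamma> F \<Longrightarrow> x \<in> F \<Longrightarrow> x \<in> elts \<Gamma>"
  "flag \<Gamma> F \<Longrightarrow> x \<in> F \<Longrightarrow> y \<in> F \<Longrightarrow> inc \<Gamma> x y"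
  by (auto simp: flag_def)

text \<open>Finiteness of the type set carries an induction on the number of types missing from a
  flag; the types 0 and 1 give every chamber a vertex and an edge.\<close>

locale graph_like_geometry =
  fixes \<Gamma> :: "('a, nat) inc_struct"
  assumes finite_types: "finite (types \<Gamma>)"
    and types01: "{0, 1} \<subseteq> types \<Gamma>"
    and geometry: "incidence_geometry \<Gamma>"
    and res_conn: "residually_connected \<Gamma>"
    and B1: "B1 \<Gamma>"
    and B2: "B2 \<Gamma>"
begin

lemma system: "incidence_system \<Gamma>"
  using geometry by (simp add: incidence_geometry_def)

lemma inc_sym: "x \<in> elts \<Gamma> \<Longrightarrow> y \<in> elts \<Gamma> \<Longrightarrow> inc \<Gamma> x y \<Longrightarrow> inc \<Gamma> y x"
  using system by (auto simp: incidence_system_def symp_on_def)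

lemma inc_refl: "x \<in> elts \<Gamma> \<Longrightarrow> inc \<Gamma> x x"
  using system by (auto simp: incidence_system_def reflp_on_def)

lemma inc_same_type:
  "x \<in> elts \<Gamma> \<Longrightarrow> y \<in> elts \<Gamma> \<Longrightarrow> inc \<Gamma> x y \<Longrightarrow> ty \<Gamma> x = ty \<Gamma> y \<Longrightarrow> x = y"
  using system by (auto simp: incidence_system_def)

lemma ty_in_types: "x \<in> elts \<Gamma> \<Longrightarrow> ty \<Gamma> x \<in> types \<Gamma>"
  using system by (auto simp: incidence_system_def)

lemma flag_insert:
  assumes "flag \<Gamma> F" "x \<in> elts \<Gamma>" "\<And>y. y \<in> F \<Longrightarrow> inc \<Gamma> x y"
  shows "flag \<Gamma> (insert x F)"
  using assms inc_sym inc_refl unfolding flag_def by (metis insertE insert_subset subsetD)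

lemma flag_extend:
  assumes "flag \<Gamma> F"
  obtains C where "chamber \<Gamma> C" "F \<subseteq> C"
  using assms geometry by (auto simp: incidence_geometry_def)

lemma chamber_type:
  assumes "chamber \<Gamma> C" "i \<in> types \<Gamma>"
  obtains x where "x \<in> C" "x \<in> elts \<Gamma>" "ty \<Gamma> x = i"
  using assms unfolding chamber_def flag_def by blast

section \<open>Edges and their ends\<close>

lemma edge_inc_iff:
  assumes "e \<in> elts_of_type \<Gamma> 1" "x \<in> elts \<Gamma>" "ty \<Gamma> x \<ge> 2"
  shows "inc \<Gamma> e x \<longleftrightarrow> shadow0 \<Gamma> e \<subseteq> shadow0 \<Gamma> x"
  using B2 assms by (auto simp: B2_def)

lemma edge_shadow:
  assumes "e \<in> elts_of_type \<Gamma> 1" "p \<in> shadow0 \<Gamma> e"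
  obtains q where "shadow0 \<Gamma> e = {p, q}" "adj \<Gamma> p q"
proof -
  have "card (shadow0 \<Gamma> e) = 2" using B1 assms(1) by (auto simp: B1_def)
  then obtain q where q: "shadow0 \<Gamma> e = {p, q}" "p \<noteq> q"
    using assms(2) by (auto simp: card_2_iff doubleton_eq_iff)
  then have "p \<in> shadow0 \<Gamma> e" "q \<in> shadow0 \<Gamma> e" by auto
  then have "adj \<Gamma> p q" using assms(1) q(2) by (auto simp: adj_def shadow0_def)
  with q(1) that show thesis by blast
qed

text \<open>Adjacency yields an edge incident with \<open>p\<close> and \<open>q\<close>; by (B1) it
  has no further vertices, so its shadow is known exactly, as applications of (B2) require.\<close>

lemma adj_edge:
  assumes "adj \<Gamma> p q"
  obtains e where "e \<in> elts_of_type \<Gamma> 1" "shadow0 \<Gamma> e = {p, q}"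
proof -
  obtain e where e: "e \<in> elts_of_type \<Gamma> 1" "p \<in> shadow0 \<Gamma> e" "q \<in> shadow0 \<Gamma> e" and "p \<noteq> q"
    using assms by (auto simp: adj_def shadow0_def)
  obtain r where "shadow0 \<Gamma> e = {p, r}" using edge_shadow[OF e(1,2)] by blast
  moreover from this e(3) \<open>p \<noteq> q\<close> have "r = q" by auto
  ultimately show thesis using that[OF e(1)] by simp
qed

section \<open>Connectedness of common shadows\<close>

text \<open>When all types in \<open>F\<close> are at least 2, this is the carrier of the residue of
  \<open>F\<close> truncated to the types 0 and 1; such elements are outside \<open>F\<close>
  automatically.\<close>

definition low_elts :: "'a set \<Rightarrow> 'a set" where
  "low_elts F = {z \<in> elts \<Gamma>. ty \<Gamma> z < 2 \<and> (\<forall>x\<in>F. inc \<Gamma> z x)}"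

text \<open>To each element of the residue of \<open>F\<close> we attach a connected set of elements of type 0 or 1:
  itself, or the low elements of its own residue (connected by induction). Incident elements have
  linked sets, so connectedness of the residue passes to its truncation.\<close>

lemma low_elts_connected:
  assumes "flag \<Gamma> F" "\<forall>x\<in>F. ty \<Gamma> x \<ge> 2" "a \<in> low_elts F" "b \<in> low_elts F"
  shows "(walk_step (low_elts F) (inc \<Gamma>))\<^sup>*\<^sup>* a b"
  using assms
proof (induction "card (types \<Gamma> - ty \<Gamma> ` F)" arbitrary: F a b rule: less_induct)
  case less
  let ?S = "(walk_step (low_elts F) (inc \<Gamma>))\<^sup>*\<^sup>*"
  let ?X = "elts (residue \<Gamma> F)"
  let ?T = "\<lambda>z. if ty \<Gamma> z < 2 then {z} else low_elts (insert z F)"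
  have X: "z \<in> ?X \<longleftrightarrow> z \<in> elts \<Gamma> \<and> z \<notin> F \<and> (\<forall>x\<in>F. inc \<Gamma> z x)" for z
    by (auto simp: residue_def)
  have flag_ins: "flag \<Gamma> (insert z F)" if "z \<in> ?X" for z
    using that less.prems(1) flag_insert by (auto simp: X)
  have conn_T: "?S c d" if z: "z \<in> ?X" and cd: "c \<in> ?T z" "d \<in> ?T z" for z c d
  proof (cases "ty \<Gamma> z < 2")
    case False
    \<comment> \<open>Incident elements of equal type coincide, so \<open>z\<close> contributes a
      new type and the number of missing types drops.\<close>
    have "ty \<Gamma> z \<notin> ty \<Gamma> ` F"
    proof
      assume "ty \<Gamma> z \<in> ty \<Gamma> ` F"
      then obtain x where "x \<in> F" "ty \<Gamma> z = ty \<Gamma> x" by blast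
      then show False using z inc_same_type[of z x] flagD(1)[OF less.prems(1)] by (auto simp: X)
    qed
    then have "card (types \<Gamma> - ty \<Gamma> ` insert z F) < card (types \<Gamma> - ty \<Gamma> ` F)"
      using z ty_in_types finite_types by (intro psubset_card_mono) (auto simp: X)
    then have "(walk_step (low_elts (insert z F)) (inc \<Gamma>))\<^sup>*\<^sup>* c d"
      using less.hyps flag_ins[OF z] less.prems(2) False cd by simp
    then show ?thesis
      by (rule rtranclp_mono[THEN predicate2D, rotated]) (auto simp: low_elts_def)
  qed (use cd in auto)
  have link: "\<exists>c\<in>?T z. \<exists>d\<in>?T w. ?S c d" if zw: "z \<in> ?X" "w \<in> ?X" "inc \<Gamma> z w" for z w
  proof -
    have low: "z \<in> low_elts F" if "ty \<Gamma> z < 2" "z \<in> ?X" for z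
      using that by (auto simp: X low_elts_def)
    consider "ty \<Gamma> z < 2" "ty \<Gamma> w < 2" | "ty \<Gamma> z < 2" "\<not> ty \<Gamma> w < 2"
      | "\<not> ty \<Gamma> z < 2" "ty \<Gamma> w < 2" | "\<not> ty \<Gamma> z < 2" "\<not> ty \<Gamma> w < 2" by blast
    then show ?thesis
    proof cases
      case 1
      then show ?thesis using low zw by auto
    next
      case 2
      \<comment> \<open>A low element incident with \<open>w\<close> belongs to the set attached to
        \<open>w\<close>, so the two sets meet.\<close>
      then have "z \<in> ?T w" using zw by (auto simp: X low_elts_def)
      then show ?thesis using 2 by auto
    next
      case 3
      then have "w \<in> ?T z" using zw inc_sym by (auto simp: X low_elts_def)
      then show ?thesis using 3 by auto
    next
      case 4
      \<comment> \<open>The vertex of a chamber through \<open>z\<close>, \<open>w\<close> and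
        \<open>F\<close> lies in both attached sets.\<close>
      have "flag \<Gamma> (insert z (insert w F))"
        using flag_insert[OF flag_ins[OF zw(2)], of z] zw by (auto simp: X)
      then obtain C where C: "chamber \<Gamma> C" "insert z (insert w F) \<subseteq> C" by (rule flag_extend)
      obtain p where p: "p \<in> C" "p \<in> elts \<Gamma>" "ty \<Gamma> p = 0"
        using chamber_type[OF C(1)] types01 by blast
      have "p \<in> ?T z \<inter> ?T w"
        using 4 p C by (auto simp: low_elts_def chamber_def flag_def)
      then show ?thesis by blast
    qed
  qed
  \<comment> \<open>The types 0 and 1 are missing from \<open>F\<close>, so the residue has rank at
    least 2 and residual connectedness applies.\<close>
  have "{0, 1} \<subseteq> types (residue \<Gamma> F)"
    using types01 less.prems(2) by (force simp: residue_def)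
  then have "card {0, 1::nat} \<le> card (types (residue \<Gamma> F))"
    using finite_types by (intro card_mono) (auto simp: residue_def)
  then have "graph_connected ?X (\<lambda>x y. x \<noteq> y \<and> inc (residue \<Gamma> F) x y)"
    using res_conn less.prems(1) by (auto simp: residually_connected_def)
  moreover have low_X: "c \<in> ?X" if "c \<in> low_elts F" for c
    using that less.prems(2) by (force simp: X low_elts_def)
  ultimately have "(walk_step ?X (\<lambda>x y. x \<noteq> y \<and> inc (residue \<Gamma> F) x y))\<^sup>*\<^sup>* a b"
    using less.prems(3,4) by (auto simp: graph_connected_def)
  \<comment> \<open>The claim is carried along the walk for the whole attached set; at the low end
    \<open>b\<close> that set is just \<open>{b}\<close>.\<close>
  then have "\<forall>c\<in>?T b. ?S a c"
  proof induction
    case base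
    then show ?case using less.prems(3) by (auto simp: low_elts_def)
  next
    case (step y z)
    then have yz: "y \<in> ?X" "z \<in> ?X" "inc \<Gamma> y z" by (auto simp: residue_def)
    obtain c d where cd: "c \<in> ?T y" "d \<in> ?T z" "?S c d" using link[OF yz] by blast
    show ?case
    proof
      fix d' assume "d' \<in> ?T z"
      then have "?S d d'" using conn_T[OF yz(2) cd(2)] by blast
      moreover have "?S a c" using step.IH cd(1) by blast
      ultimately show "?S a d'" using cd(3) by (meson rtranclp_trans)
    qed
  qed
  then show ?case using less.prems(4) by (auto simp: low_elts_def)
qed

lemma edge_in_common_shadow:
  assumes "flag \<Gamma> F" "\<forall>x\<in>F. ty \<Gamma> x \<ge> 2" "e \<in> elts_of_type \<Gamma> 1" "\<forall>x\<in>F. inc \<Gamma> e x"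
  shows "shadow0 \<Gamma> e \<subseteq> common_shadow \<Gamma> F"
proof
  fix p assume p: "p \<in> shadow0 \<Gamma> e"
  have "p \<in> shadow0 \<Gamma> x" if "x \<in> F" for x
    using assms p edge_inc_iff[OF assms(3) flagD(1)[OF assms(1) that]] that by auto
  then show "p \<in> common_shadow \<Gamma> F" using p by (auto simp: common_shadow_def shadow0_def)
qed

text \<open>A walk through low elements alternates, up to repetitions, between vertices and edges.
  By (B2) both ends of each edge lie in the common shadow, so contracting the edges leaves a walk of
  vertices.\<close>

lemma common_shadow_connected:
  assumes F: "flag \<Gamma> F" "\<forall>x\<in>F. ty \<Gamma> x \<ge> 2"
    and p: "p \<in> common_shadow \<Gamma> F" and q: "q \<in> common_shadow \<Gamma> F"
  shows "(walk_step (common_shadow \<Gamma> F) (adj \<Gamma>))\<^sup>*\<^sup>* p q"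
proof -
  let ?S = "(walk_step (common_shadow \<Gamma> F) (adj \<Gamma>))\<^sup>*\<^sup>*"
  have low: "r \<in> low_elts F" if "r \<in> common_shadow \<Gamma> F" for r
    using that by (auto simp: common_shadow_def elts_of_type_def low_elts_def)
  have "(walk_step (low_elts F) (inc \<Gamma>))\<^sup>*\<^sup>* p q"
    using low_elts_connected[OF F] low p q by blast
  \<comment> \<open>The invariant at an edge is that both of its ends are reached, whichever end the
    walk leaves by.\<close>
  then have "(ty \<Gamma> q = 0 \<longrightarrow> ?S p q) \<and> (ty \<Gamma> q = 1 \<longrightarrow> (\<forall>r\<in>shadow0 \<Gamma> q. ?S p r))"
  proof induction
    case base
    then show ?case using p by (auto simp: common_shadow_def elts_of_type_def)
  next
    case (step b c)
    then have bc: "b \<in> elts \<Gamma>" "c \<in> elts \<Gamma>" "inc \<Gamma> b c" "ty \<Gamma> b < 2" "ty \<Gamma> c < 2"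
      "\<forall>x\<in>F. inc \<Gamma> c x"
      by (auto simp: low_elts_def)
    consider "ty \<Gamma> b = ty \<Gamma> c" | "ty \<Gamma> b = 0" "ty \<Gamma> c = 1" | "ty \<Gamma> b = 1" "ty \<Gamma> c = 0"
      using bc(4,5) by linarith
    then show ?case
    proof cases
      case 1
      then show ?thesis using inc_same_type[OF bc(1-3)] step.IH by simp
    next
      case 2
      then have c: "c \<in> elts_of_type \<Gamma> 1" and b: "b \<in> shadow0 \<Gamma> c"
        using bc by (auto simp: elts_of_type_def shadow0_def)
      obtain r where r: "shadow0 \<Gamma> c = {b, r}" "adj \<Gamma> b r" using edge_shadow[OF c b] by blast
      have "?S p b" using 2 step.IH by blast
      moreover have "?S b r"
        using edge_in_common_shadow[OF F c bc(6)] r by auto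
      ultimately show ?thesis using 2 r(1) by (auto intro: rtranclp_trans)
    next
      case 3
      then have "c \<in> shadow0 \<Gamma> b" using bc inc_sym[OF bc(1-3)] by (auto simp: elts_of_type_def shadow0_def)
      then show ?thesis using 3 step.IH by auto
    qed
  qed
  then show ?thesis using q by (auto simp: common_shadow_def elts_of_type_def)
qed

lemma flag_singleton: "x \<in> elts \<Gamma> \<Longrightarrow> flag \<Gamma> {x}"
  by (simp add: flag_def inc_refl)

lemma shadow0_connected:
  assumes "x \<in> elts \<Gamma>" "ty \<Gamma> x \<ge> 2" "p \<in> shadow0 \<Gamma> x" "q \<in> shadow0 \<Gamma> x"
  shows "(walk_step (shadow0 \<Gamma> x) (adj \<Gamma>))\<^sup>*\<^sup>* p q"
  using common_shadow_connected[OF flag_singleton[OF assms(1)]] assms(2-4)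
  by (simp add: common_shadow_singleton)

text \<open>The edge of a chamber through \<open>p\<close> and \<open>F\<close> has a second end,
  which (B2) places in the common shadow.\<close>

lemma common_shadow_neighbour:
  assumes F: "flag \<Gamma> F" "\<forall>x\<in>F. ty \<Gamma> x \<ge> 2" and p: "p \<in> common_shadow \<Gamma> F"
  obtains q where "q \<in> common_shadow \<Gamma> F" "adj \<Gamma> p q"
proof -
  have "flag \<Gamma> (insert p F)"
    using p by (intro flag_insert[OF F(1)]) (auto simp: common_shadow_def elts_of_type_def)
  then obtain C where C: "chamber \<Gamma> C" "insert p F \<subseteq> C" by (rule flag_extend)
  obtain e where e: "e \<in> C" "e \<in> elts_of_type \<Gamma> 1"
    using chamber_type[OF C(1), of 1] types01 by (auto simp: elts_of_type_def)
  have inc_C: "inc \<Gamma> x y" if "x \<in> C" "y \<in> C" for x y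
    using C(1) that by (auto simp: chamber_def flag_def)
  have "p \<in> shadow0 \<Gamma> e"
    using p C(2) e inc_C by (auto simp: shadow0_def common_shadow_def)
  then obtain q where q: "shadow0 \<Gamma> e = {p, q}" "adj \<Gamma> p q" using edge_shadow[OF e(2)] by blast
  have "shadow0 \<Gamma> e \<subseteq> common_shadow \<Gamma> F"
    using edge_in_common_shadow[OF F e(2)] e(1) C(2) inc_C by auto
  with q that show thesis by auto
qed

lemma common_shadow_nonempty:
  assumes F: "flag \<Gamma> F"
  obtains p where "p \<in> common_shadow \<Gamma> F"
proof -
  obtain C where C: "chamber \<Gamma> C" "F \<subseteq> C" using F by (rule flag_extend)
  obtain p where "p \<in> C" "p \<in> elts \<Gamma>" "ty \<Gamma> p = 0"
    using chamber_type[OF C(1)] types01 by blast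
  then have "p \<in> common_shadow \<Gamma> F"
    using C by (auto simp: common_shadow_def elts_of_type_def chamber_def flag_def)
  with that show thesis .
qed

section \<open>Flags and chambers of the parity system\<close>

text \<open>Passing to the residue of \<open>x\<close> could only lose edges; (B2) keeps every edge
  with both ends in the shadow of \<open>x\<close>.\<close>

lemma
  assumes x: "x \<in> elts \<Gamma>" "ty \<Gamma> x \<ge> 2"
  shows verts_res01: "verts (res01 \<Gamma> x) = shadow0 \<Gamma> x"
    and adj_res01: "p \<in> shadow0 \<Gamma> x \<Longrightarrow> q \<in> shadow0 \<Gamma> x \<Longrightarrow> adj (res01 \<Gamma> x) p q \<longleftrightarrow> adj \<Gamma> p q"
proof -
  show V: "verts (res01 \<Gamma> x) = shadow0 \<Gamma> x"
    using x by (auto simp: elts_of_type_def truncation_def residue_def shadow0_def)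
  assume pq: "p \<in> shadow0 \<Gamma> x" "q \<in> shadow0 \<Gamma> x"
  show "adj (res01 \<Gamma> x) p q \<longleftrightarrow> adj \<Gamma> p q"
  proof
    assume "adj (res01 \<Gamma> x) p q"
    then show "adj \<Gamma> p q"
      by (auto simp: adj_def elts_of_type_def truncation_def residue_def)
  next
    assume a: "adj \<Gamma> p q"
    then obtain e where e: "e \<in> elts_of_type \<Gamma> 1" "shadow0 \<Gamma> e = {p, q}" by (rule adj_edge)
    then have "inc \<Gamma> e x" using edge_inc_iff[OF e(1) x] pq by auto
    then have "e \<in> elts_of_type (res01 \<Gamma> x) 1"
      using e(1) x(2) by (auto simp: elts_of_type_def truncation_def residue_def)
    moreover have "p \<in> shadow0 \<Gamma> e" "q \<in> shadow0 \<Gamma> e" using e by auto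
    then have "inc (res01 \<Gamma> x) p e" "inc (res01 \<Gamma> x) q e"
      by (auto simp: truncation_def residue_def shadow0_def)
    moreover have "p \<noteq> q" using a by (auto simp: adj_def)
    ultimately show "adj (res01 \<Gamma> x) p q" using pq V by (auto simp: adj_def)
  qed
qed

lemma walk_step_res01:
  assumes x: "x \<in> elts \<Gamma>" "ty \<Gamma> x \<ge> 2"
  shows "walk_step (verts (res01 \<Gamma> x)) (adj (res01 \<Gamma> x)) = walk_step (shadow0 \<Gamma> x) (adj \<Gamma>)"
  using verts_res01[OF x] adj_res01[OF x] by (auto simp: fun_eq_iff)

lemma parity_classes_eq:
  assumes x: "x \<in> elts \<Gamma>" "ty \<Gamma> x \<ge> 2"
  shows "parity_classes \<Gamma> x = even_classes (shadow0 \<Gamma> x) (adj \<Gamma>)"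
  unfolding parity_classes_def even_classes_def even_walk_rel_def walk_step_res01[OF x]
  unfolding verts_res01[OF x] ..

lemma parity_opposite_eq:
  assumes x: "x \<in> elts \<Gamma>" "ty \<Gamma> x \<ge> 2"
  shows "parity_opposite \<Gamma> x P = opposite_class (shadow0 \<Gamma> x) (adj \<Gamma>) P"
proof -
  have "graph_bipartite (verts (res01 \<Gamma> x)) (adj (res01 \<Gamma> x))
      \<longleftrightarrow> graph_bipartite (shadow0 \<Gamma> x) (adj \<Gamma>)"
    unfolding graph_bipartite_def verts_res01[OF x]
    by (intro ex_cong conj_cong ball_cong refl) (simp only: adj_res01[OF x])
  then show ?thesis
    unfolding parity_opposite_def opposite_class_def verts_res01[OF x] by simp
qed

lemma parity_opposite_adjacent:
  assumes "x \<in> elts \<Gamma>" "ty \<Gamma> x \<ge> 2" "P \<in> parity_classes \<Gamma> x"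
    and "p \<in> shadow0 \<Gamma> x" "q \<in> shadow0 \<Gamma> x" "adj \<Gamma> p q"
  shows "q \<in> parity_opposite \<Gamma> x P \<longleftrightarrow> p \<in> P"
  using opposite_class_adjacent[of "adj \<Gamma>" "shadow0 \<Gamma> x" P p q, OF adj_sym shadow0_connected]
    assms parity_classes_eq[OF assms(1,2)] parity_opposite_eq[OF assms(1,2)] by auto

section \<open>Parity classes of an element\<close>

lemma equiv_shadow0: "equiv (shadow0 \<Gamma> x) (even_walk_rel (shadow0 \<Gamma> x) (adj \<Gamma>))"
  by (rule equiv_even_walk_rel) (rule adj_sym)

text \<open>Any member generates its equivalence class; once a vertex \<open>p\<close> is fixed,
  \<open>x\<close> has only one class containing it.\<close>

lemma parity_class_eq:
  assumes "x \<in> elts \<Gamma>" "ty \<Gamma> x \<ge> 2" "P \<in> parity_classes \<Gamma> x" "p \<in> P"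
  shows "P = even_walk_rel (shadow0 \<Gamma> x) (adj \<Gamma>) `` {p}"
proof -
  have "P \<in> shadow0 \<Gamma> x // even_walk_rel (shadow0 \<Gamma> x) (adj \<Gamma>)"
    using assms(1-3) by (simp add: parity_classes_eq even_classes_def)
  then obtain w where w: "P = even_walk_rel (shadow0 \<Gamma> x) (adj \<Gamma>) `` {w}" by (rule quotientE)
  then show ?thesis using equiv_class_eq[OF equiv_shadow0, of w p x] assms(4) by simp
qed

lemma parity_class_subset:
  assumes "x \<in> elts \<Gamma>" "ty \<Gamma> x \<ge> 2" "P \<in> parity_classes \<Gamma> x"
  shows "P \<subseteq> shadow0 \<Gamma> x"
  using assms by (auto simp: parity_classes_eq even_classes_def even_walk_rel_def elim!: quotientE)

lemma parity_class_nonempty: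
  assumes "x \<in> elts \<Gamma>" "ty \<Gamma> x \<ge> 2" "P \<in> parity_classes \<Gamma> x"
  shows "P \<noteq> {}"
  using in_quotient_imp_non_empty[OF equiv_shadow0] assms
  by (simp add: parity_classes_eq even_classes_def)

lemma parity_class_nonbipartite:
  assumes "x \<in> elts \<Gamma>" "ty \<Gamma> x \<ge> 2" "P \<in> parity_classes \<Gamma> x"
    and "\<not> graph_bipartite (shadow0 \<Gamma> x) (adj \<Gamma>)"
  shows "P = shadow0 \<Gamma> x"
proof -
  obtain p where p: "p \<in> P" using parity_class_nonempty[OF assms(1-3)] by blast
  have "p \<in> shadow0 \<Gamma> x" using p parity_class_subset[OF assms(1-3)] by blast
  then have "shadow0 \<Gamma> x \<subseteq> even_walk_rel (shadow0 \<Gamma> x) (adj \<Gamma>) `` {p}"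
    using even_walk_rel_nonbipartite[of "adj \<Gamma>" "shadow0 \<Gamma> x" p,
        OF adj_sym shadow0_connected[OF assms(1,2)] assms(4)] by auto
  then show ?thesis
    using parity_class_eq[OF assms(1-3) p] parity_class_subset[OF assms(1-3)] by auto
qed

text \<open>A walk in the connected common shadow from a shared vertex \<open>r\<close> to
  \<open>p\<close> lies in both graphs. Bipartiteness on the side of \<open>x\<close> forces it to
  be even, and an even walk keeps \<open>p\<close> in the class \<open>Q\<close> of
  \<open>r\<close>.\<close>

lemma incident_classes_agree:
  assumes x: "x \<in> elts \<Gamma>" "ty \<Gamma> x \<ge> 2" "P \<in> parity_classes \<Gamma> x"
    and y: "y \<in> elts \<Gamma>" "ty \<Gamma> y \<ge> 2" "Q \<in> parity_classes \<Gamma> y"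
    and xy: "inc \<Gamma> x y" "P \<inter> Q \<noteq> {}"
    and bip: "graph_bipartite (shadow0 \<Gamma> x) (adj \<Gamma>)"
    and p: "p \<in> P" "p \<in> shadow0 \<Gamma> y"
  shows "p \<in> Q"
proof -
  obtain r where r: "r \<in> P" "r \<in> Q" using xy(2) by blast
  have rV: "r \<in> shadow0 \<Gamma> x" "r \<in> shadow0 \<Gamma> y" and pV: "p \<in> shadow0 \<Gamma> x"
    using r p parity_class_subset x y by blast+
  obtain A where A: "\<forall>u\<in>shadow0 \<Gamma> x. \<forall>v\<in>shadow0 \<Gamma> x. adj \<Gamma> u v \<longrightarrow> (u \<in> A \<longleftrightarrow> v \<notin> A)"
    using bip unfolding graph_bipartite_def by (elim exE conjE) (rule that)
  have cs: "common_shadow \<Gamma> {x, y} = shadow0 \<Gamma> x \<inter> shadow0 \<Gamma> y"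
    by (auto simp: common_shadow_def shadow0_def)
  have "flag \<Gamma> {x, y}" using flag_insert[OF flag_singleton[OF y(1)] x(1)] xy(1) by simp
  then have "(walk_step (common_shadow \<Gamma> {x, y}) (adj \<Gamma>))\<^sup>*\<^sup>* r p"
    using common_shadow_connected[of "{x, y}" r p] x(2) y(2) rV pV p(2) cs by auto
  then obtain k where k: "(walk_step (common_shadow \<Gamma> {x, y}) (adj \<Gamma>) ^^ k) r p"
    by (auto simp: rtranclp_power)
  have kx: "(walk_step (shadow0 \<Gamma> x) (adj \<Gamma>) ^^ k) r p"
    by (rule relpowp_mono[OF _ k]) (auto simp: cs)
  have ky: "(walk_step (shadow0 \<Gamma> y) (adj \<Gamma>) ^^ k) r p"
    by (rule relpowp_mono[OF _ k]) (auto simp: cs)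
  have "(r, p) \<in> even_walk_rel (shadow0 \<Gamma> x) (adj \<Gamma>)"
    using parity_class_eq[OF x r(1)] p(1) by blast
  then obtain l where l: "(walk_step (shadow0 \<Gamma> x) (adj \<Gamma>) ^^ (2 * l)) r p"
    by (auto simp: even_walk_rel_def)
  \<comment> \<open>The even walk inside \<open>P\<close> has the same ends as the walk of length
    \<open>k\<close>, so the colouring gives both the same parity.\<close>
  have "even k" using walk_bipartition[OF A kx] walk_bipartition[OF A l] by simp
  then have "(r, p) \<in> even_walk_rel (shadow0 \<Gamma> y) (adj \<Gamma>)"
    using even_walk_relI[OF rV(2) p(2) ky] by blast
  then show ?thesis using parity_class_eq[OF y r(2)] by blast
qed

section \<open>The edge determined by a flag\<close>

text \<open>The classes are forgotten. Within a flag this loses no element, because incidence at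
  equal type includes equality of the classes.\<close>

definition high :: "'a pelt set \<Rightarrow> 'a set" where
  "high H = {x. \<exists>P. PHigh x P \<in> H}"

lemma parity_elts:
  "PZero p \<in> elts (parity_system \<Gamma>) \<longleftrightarrow> p \<in> elts_of_type \<Gamma> 0"
  "POne p \<in> elts (parity_system \<Gamma>) \<longleftrightarrow> p \<in> elts_of_type \<Gamma> 0"
  "PHigh x P \<in> elts (parity_system \<Gamma>) \<longleftrightarrow> x \<in> elts \<Gamma> \<and> ty \<Gamma> x \<ge> 2 \<and> P \<in> parity_classes \<Gamma> x"
  by (auto simp: parity_system_def)

lemma parity_inc: "inc (parity_system \<Gamma>) = pinc \<Gamma>"
  and parity_ty: "ty (parity_system \<Gamma>) = ptyp \<Gamma>"
  and parity_types: "types (parity_system \<Gamma>) = types \<Gamma>"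
  by (simp_all add: parity_system_def)

lemma parity_flag_inc:
  assumes "flag (parity_system \<Gamma>) H" "a \<in> H" "b \<in> H"
  shows "pinc \<Gamma> a b"
  using flagD(2)[OF assms] by (simp add: parity_inc)

lemma parity_flag_high:
  assumes "flag (parity_system \<Gamma>) H" "PHigh x P \<in> H"
  shows "x \<in> elts \<Gamma>" "ty \<Gamma> x \<ge> 2" "P \<in> parity_classes \<Gamma> x"
  using flagD(1)[OF assms] by (auto simp: parity_elts)

lemma high_flag:
  assumes H: "flag (parity_system \<Gamma>) H"
  shows "flag \<Gamma> (high H)" "\<forall>x\<in>high H. ty \<Gamma> x \<ge> 2"
proof -
  have "inc \<Gamma> x y" if "PHigh x P \<in> H" "PHigh y Q \<in> H" for x y P Q
    using parity_flag_inc[OF H that] parity_flag_high[OF H that(1)] inc_refl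
    by (auto split: if_splits)
  then show "flag \<Gamma> (high H)"
    using parity_flag_high[OF H] by (auto simp: flag_def high_def)
  show "\<forall>x\<in>high H. ty \<Gamma> x \<ge> 2" using parity_flag_high[OF H] by (auto simp: high_def)
qed

text \<open>One element with bipartite graph controls the whole flag: a vertex of its class in the
  common shadow lies in all other classes. If there is no such element, every class is a full shadow
  and any common vertex serves.\<close>

lemma high_common_vertex:
  assumes H: "flag (parity_system \<Gamma>) H"
  obtains p where "p \<in> common_shadow \<Gamma> (high H)" "\<And>x P. PHigh x P \<in> H \<Longrightarrow> p \<in> P"
proof -
  note F = high_flag[OF H]
  obtain p0 where p0: "p0 \<in> common_shadow \<Gamma> (high H)" using F(1) by (rule common_shadow_nonempty)
  have cs: "r \<in> shadow0 \<Gamma> x" if "r \<in> common_shadow \<Gamma> (high H)" "PHigh x P \<in> H" for r x P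
    using that by (auto simp: common_shadow_def high_def shadow0_def)
  show thesis
  proof (cases "\<exists>x P. PHigh x P \<in> H \<and> graph_bipartite (shadow0 \<Gamma> x) (adj \<Gamma>)")
    case True
    then obtain x P where xP: "PHigh x P \<in> H" and bip: "graph_bipartite (shadow0 \<Gamma> x) (adj \<Gamma>)"
      by blast
    note x = parity_flag_high[OF H xP]
    obtain q0 where q0: "q0 \<in> common_shadow \<Gamma> (high H)" "adj \<Gamma> p0 q0"
      using common_shadow_neighbour[OF F p0] by blast
    \<comment> \<open>The ends of the edge have different colours in the graph of \<open>x\<close>,
      so one of them lies in \<open>P\<close>.\<close>
    have "q0 \<in> parity_opposite \<Gamma> x P \<longleftrightarrow> p0 \<in> P"
      using parity_opposite_adjacent[OF x] cs[OF p0 xP] cs[OF q0(1) xP] q0(2) by blast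
    moreover have "parity_opposite \<Gamma> x P = shadow0 \<Gamma> x - P"
      using bip by (simp add: parity_opposite_eq[OF x(1,2)] opposite_class_def)
    ultimately have "p0 \<in> P \<or> q0 \<in> P" using cs[OF q0(1) xP] by blast
    then obtain p where p: "p \<in> common_shadow \<Gamma> (high H)" "p \<in> P" using p0 q0(1) by blast
    have "p \<in> Q" if yQ: "PHigh y Q \<in> H" for y Q
    proof (cases "ty \<Gamma> x = ty \<Gamma> y")
      case True
      then show ?thesis using parity_flag_inc[OF H xP yQ] p(2) by auto
    next
      case False
      then show ?thesis
        using parity_flag_inc[OF H xP yQ] cs[OF p(1) yQ] p(2) bip
          incident_classes_agree[OF x parity_flag_high[OF H yQ]] by auto
    qed
    with p(1) that show thesis by blast
  next
    case False
    have "p0 \<in> P" if xP: "PHigh x P \<in> H" for x P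
      using parity_class_nonbipartite[OF parity_flag_high[OF H xP]] False xP cs[OF p0 xP] by blast
    with p0 that show thesis by blast
  qed
qed

text \<open>Elements of types 0 and 1 in \<open>H\<close> dictate \<open>p\<close> and
  \<open>q\<close>; missing ends are chosen as neighbours. The classes are compared with
  \<open>p\<close> alone, since adjacency then puts \<open>q\<close> into the opposite
  classes.\<close>

lemma parity_flag_edge:
  assumes H: "flag (parity_system \<Gamma>) H"
  obtains p q where "p \<in> common_shadow \<Gamma> (high H)" "q \<in> common_shadow \<Gamma> (high H)" "adj \<Gamma> p q"
    "\<And>r. PZero r \<in> H \<Longrightarrow> r = p" "\<And>r. POne r \<in> H \<Longrightarrow> r = q" "\<And>x P. PHigh x P \<in> H \<Longrightarrow> p \<in> P"
proof -
  note F = high_flag[OF H]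
  note pinc = parity_flag_inc[OF H]
  have cs: "r \<in> shadow0 \<Gamma> x" if "r \<in> common_shadow \<Gamma> (high H)" "PHigh x P \<in> H" for r x P
    using that by (auto simp: common_shadow_def high_def shadow0_def)
  have zero: "p \<in> common_shadow \<Gamma> (high H) \<and> (\<forall>r. PZero r \<in> H \<longrightarrow> r = p)
      \<and> (\<forall>x P. PHigh x P \<in> H \<longrightarrow> p \<in> P)" if p: "PZero p \<in> H" for p
    using flagD(1)[OF H p] pinc[OF p] by (force simp: parity_elts common_shadow_def high_def)
  have one: "q \<in> common_shadow \<Gamma> (high H) \<and> (\<forall>r. POne r \<in> H \<longrightarrow> r = q)
      \<and> (\<forall>x P. PHigh x P \<in> H \<longrightarrow> q \<in> parity_opposite \<Gamma> x P)" if q: "POne q \<in> H" for q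
    using flagD(1)[OF H q] pinc[OF q] by (force simp: parity_elts common_shadow_def high_def)
  show thesis
  proof (cases "\<exists>q. POne q \<in> H")
    case True
    then obtain q where q: "POne q \<in> H" by blast
    show thesis
    proof (cases "\<exists>p. PZero p \<in> H")
      case True
      then obtain p where p: "PZero p \<in> H" by blast
      have "adj \<Gamma> p q" using pinc[OF p q] adj_truncation[of \<Gamma>] by simp
      then show thesis using that[of p q] zero[OF p] one[OF q] by blast
    next
      case False
      obtain p where p: "p \<in> common_shadow \<Gamma> (high H)" "adj \<Gamma> q p"
        using common_shadow_neighbour[OF F] one[OF q] by blast
      \<comment> \<open>Any neighbour of \<open>q\<close> in the common shadow will do: being in
        \<open>P\<close> is equivalent to \<open>q\<close> being in the opposite class.\<close>
      have "p \<in> P" if xP: "PHigh x P \<in> H" for x P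
      proof -
        have "q \<in> shadow0 \<Gamma> x" "q \<in> parity_opposite \<Gamma> x P" using one[OF q] cs xP by simp_all
        then show ?thesis
          using parity_opposite_adjacent[OF parity_flag_high[OF H xP] cs[OF p(1) xP]]
            adj_sym[OF p(2)] by simp
      qed
      then show thesis using that[OF p(1) _ adj_sym[OF p(2)]] one[OF q] False by blast
    qed
  next
    case False
    have "\<exists>p. p \<in> common_shadow \<Gamma> (high H) \<and> (\<forall>r. PZero r \<in> H \<longrightarrow> r = p)
        \<and> (\<forall>x P. PHigh x P \<in> H \<longrightarrow> p \<in> P)"
    proof (cases "\<exists>p. PZero p \<in> H")
      case True
      then show ?thesis using zero by blast
    next
      case no_zero: False
      then show ?thesis using high_common_vertex[OF H] by metis
    qed
    then obtain p where p: "p \<in> common_shadow \<Gamma> (high H)" "\<forall>r. PZero r \<in> H \<longrightarrow> r = p"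
      "\<forall>x P. PHigh x P \<in> H \<longrightarrow> p \<in> P" by blast
    obtain q where "q \<in> common_shadow \<Gamma> (high H)" "adj \<Gamma> p q"
      using common_shadow_neighbour[OF F p(1)] by blast
    then show thesis using that[of p q] p False by blast
  qed
qed

section \<open>Lifting chambers\<close>

text \<open>Two distinct vertices never lie in one flag, so the chamber is taken through the edge
  joining them; (B2) then puts both ends into the shadow of each of its elements of type at least
  2.\<close>

lemma chamber_through_edge:
  assumes F: "flag \<Gamma> F" "\<forall>x\<in>F. ty \<Gamma> x \<ge> 2"
    and pq: "p \<in> common_shadow \<Gamma> F" "q \<in> common_shadow \<Gamma> F" "adj \<Gamma> p q"
  obtains C where "chamber \<Gamma> C" "F \<subseteq> C"
    "\<And>x. x \<in> C \<Longrightarrow> ty \<Gamma> x \<ge> 2 \<Longrightarrow> p \<in> shadow0 \<Gamma> x \<and> q \<in> shadow0 \<Gamma> x"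
proof -
  obtain e where e: "e \<in> elts_of_type \<Gamma> 1" "shadow0 \<Gamma> e = {p, q}" using pq(3) by (rule adj_edge)
  have "inc \<Gamma> e x" if "x \<in> F" for x
    using edge_inc_iff[OF e(1) flagD(1)[OF F(1) that]] F(2) that pq e(2)
    by (auto simp: common_shadow_def shadow0_def)
  then have "flag \<Gamma> (insert e F)"
    using e(1) by (intro flag_insert[OF F(1)]) (auto simp: elts_of_type_def)
  then obtain C where C: "chamber \<Gamma> C" "insert e F \<subseteq> C" by (rule flag_extend)
  have "p \<in> shadow0 \<Gamma> x \<and> q \<in> shadow0 \<Gamma> x" if x: "x \<in> C" "ty \<Gamma> x \<ge> 2" for x
  proof -
    have "x \<in> elts \<Gamma>" "inc \<Gamma> e x" using C x by (auto simp: chamber_def flag_def)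
    then have "shadow0 \<Gamma> e \<subseteq> shadow0 \<Gamma> x" using edge_inc_iff[OF e(1)] x(2) by blast
    then show ?thesis using e(2) by simp
  qed
  with C that show thesis by blast
qed

text \<open>The elements of \<open>C\<close> of types 0 and 1 are replaced by the two ends of the
  chosen edge, and every other element receives its class through \<open>p\<close>.\<close>

definition chamber_lift :: "'a set \<Rightarrow> 'a \<Rightarrow> 'a \<Rightarrow> 'a pelt set" where
  "chamber_lift C p q = {PZero p, POne q} \<union>
     (\<lambda>x. PHigh x (even_walk_rel (shadow0 \<Gamma> x) (adj \<Gamma>) `` {p})) ` {x \<in> C. ty \<Gamma> x \<ge> 2}"

lemma chamber_lift_chamber:
  assumes C: "chamber \<Gamma> C" and pq: "adj \<Gamma> p q"
    and sh: "\<And>x. x \<in> C \<Longrightarrow> ty \<Gamma> x \<ge> 2 \<Longrightarrow> p \<in> shadow0 \<Gamma> x \<and> q \<in> shadow0 \<Gamma> x"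
  shows "chamber (parity_system \<Gamma>) (chamber_lift C p q)"
proof -
  let ?c = "\<lambda>x. even_walk_rel (shadow0 \<Gamma> x) (adj \<Gamma>) `` {p}"
  have el: "x \<in> elts \<Gamma>" if "x \<in> C" for x using C that by (auto simp: chamber_def flag_def)
  have inc_C: "inc \<Gamma> x y" if "x \<in> C" "y \<in> C" for x y
    using C that by (auto simp: chamber_def flag_def)
  have cls: "?c x \<in> parity_classes \<Gamma> x" if "x \<in> C" "ty \<Gamma> x \<ge> 2" for x
    using sh[OF that] el[OF that(1)] that(2)
    by (auto simp: parity_classes_eq even_classes_def intro: quotientI)
  have p_in: "p \<in> ?c x" if "x \<in> C" "ty \<Gamma> x \<ge> 2" for x
    using equiv_class_self[OF equiv_shadow0] sh[OF that] by blast
  \<comment> \<open>Adjacency of \<open>p\<close> and \<open>q\<close> transfers \<open>p_in\<close>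
    to the opposite class.\<close>
  have q_in: "q \<in> parity_opposite \<Gamma> x (?c x)" if "x \<in> C" "ty \<Gamma> x \<ge> 2" for x
    using parity_opposite_adjacent[OF el[OF that(1)] that(2) cls[OF that]] sh[OF that] pq p_in[OF that]
    by blast
  have V: "p \<in> elts_of_type \<Gamma> 0" "q \<in> elts_of_type \<Gamma> 0" using pq by (auto simp: adj_def)
  have inc_V: "inc \<Gamma> p x" "inc \<Gamma> q x" if "x \<in> C" "ty \<Gamma> x \<ge> 2" for x
    using sh[OF that] by (auto simp: shadow0_def)
  \<comment> \<open>All chosen classes contain \<open>p\<close>, hence meet pairwise.\<close>
  have meet: "?c x \<inter> ?c y \<noteq> {}" if "x \<in> C" "ty \<Gamma> x \<ge> 2" "y \<in> C" "ty \<Gamma> y \<ge> 2" for x y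
    using p_in that by blast
  have same: "x = y" if "x \<in> C" "y \<in> C" "ty \<Gamma> x = ty \<Gamma> y" for x y
    using inc_same_type that inc_C el by blast
  have pinc_hh: "pinc \<Gamma> (PHigh x (?c x)) (PHigh y (?c y))"
    if xy: "x \<in> C" "ty \<Gamma> x \<ge> 2" "y \<in> C" "ty \<Gamma> y \<ge> 2" for x y
  proof (cases "ty \<Gamma> x = ty \<Gamma> y")
    case True
    then show ?thesis using same xy by auto
  next
    case False
    then show ?thesis using meet[OF xy] inc_C xy by simp
  qed
  have zh: "pinc \<Gamma> (PZero p) (PHigh x (?c x))" "pinc \<Gamma> (PHigh x (?c x)) (PZero p)"
    and oh: "pinc \<Gamma> (POne q) (PHigh x (?c x))" "pinc \<Gamma> (PHigh x (?c x)) (POne q)"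
    if "x \<in> C" "ty \<Gamma> x \<ge> 2" for x
    unfolding pinc.simps using p_in[OF that] q_in[OF that] inc_V[OF that] by blast+
  have adj01: "pinc \<Gamma> (PZero p) (POne q)" "pinc \<Gamma> (POne q) (PZero p)"
    using pq adj_truncation[of \<Gamma>] by simp_all
  have "pinc \<Gamma> a b" if "a \<in> chamber_lift C p q" "b \<in> chamber_lift C p q" for a b
    using that unfolding chamber_lift_def
    by (elim UnE insertE emptyE imageE CollectE conjE)
      (simp_all only: pinc_hh zh oh adj01 pinc.simps(1,2))
  moreover have "chamber_lift C p q \<subseteq> elts (parity_system \<Gamma>)"
    using V cls el by (auto simp: chamber_lift_def parity_elts)
  ultimately have "flag (parity_system \<Gamma>) (chamber_lift C p q)"
    by (auto simp: flag_def parity_inc)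
  moreover have "\<exists>!a. a \<in> chamber_lift C p q \<and> ptyp \<Gamma> a = i" if i: "i \<in> types \<Gamma>" for i
  proof -
    consider "i = 0" | "i = 1" | "i \<ge> 2" by linarith
    then show ?thesis
    proof cases
      case 1
      then show ?thesis by (intro ex1I[of _ "PZero p"]) (auto simp: chamber_lift_def)
    next
      case 2
      then show ?thesis by (intro ex1I[of _ "POne q"]) (auto simp: chamber_lift_def)
    next
      case 3
      obtain x where x: "x \<in> C" "ty \<Gamma> x = i" using chamber_type[OF C i] by blast
      then show ?thesis
        using 3 by (intro ex1I[of _ "PHigh x (?c x)"])
          (auto simp: chamber_lift_def dest: same[OF _ x(1)])
    qed
  qed
  ultimately show ?thesis by (simp add: chamber_def parity_ty parity_types)
qed

lemma parity_flag_extend: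
  assumes H: "flag (parity_system \<Gamma>) H"
  shows "\<exists>D. chamber (parity_system \<Gamma>) D \<and> H \<subseteq> D"
proof -
  obtain p q where pq: "p \<in> common_shadow \<Gamma> (high H)" "q \<in> common_shadow \<Gamma> (high H)" "adj \<Gamma> p q"
    and zero: "\<And>r. PZero r \<in> H \<Longrightarrow> r = p" and one: "\<And>r. POne r \<in> H \<Longrightarrow> r = q"
    and cls: "\<And>x P. PHigh x P \<in> H \<Longrightarrow> p \<in> P"
    using H by (rule parity_flag_edge) blast
  obtain C where C: "chamber \<Gamma> C" "high H \<subseteq> C"
    "\<And>x. x \<in> C \<Longrightarrow> ty \<Gamma> x \<ge> 2 \<Longrightarrow> p \<in> shadow0 \<Gamma> x \<and> q \<in> shadow0 \<Gamma> x"
    using high_flag[OF H] pq by (rule chamber_through_edge) blast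
  have "H \<subseteq> chamber_lift C p q"
  proof
    fix a assume a: "a \<in> H"
    show "a \<in> chamber_lift C p q"
    proof (cases a)
      case (PHigh x P)
      note x = parity_flag_high[OF H a[unfolded PHigh]]
      \<comment> \<open>Since \<open>P\<close> contains \<open>p\<close>, it is the class that the
        lift assigns to \<open>x\<close>.\<close>
      have "P = even_walk_rel (shadow0 \<Gamma> x) (adj \<Gamma>) `` {p}"
        using parity_class_eq[OF x] cls a PHigh by blast
      moreover have "x \<in> C" using a PHigh C(2) by (auto simp: high_def)
      ultimately show ?thesis using PHigh x(2) by (auto simp: chamber_lift_def)
    qed (use a zero one in \<open>auto simp: chamber_lift_def\<close>)
  qed
  then show ?thesis using chamber_lift_chamber[OF C(1) pq(3) C(3)] by blast
qed

section \<open>Axioms of an incidence system\<close>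

lemma pinc_refl: "pinc \<Gamma> a a"
  by (cases a) auto

lemma pinc_sym:
  assumes "a \<in> elts (parity_system \<Gamma>)" "b \<in> elts (parity_system \<Gamma>)" "pinc \<Gamma> a b"
  shows "pinc \<Gamma> b a"
  using assms
  by (cases a; cases b) (auto simp: parity_elts Int_commute split: if_splits intro: inc_sym)

lemma pinc_same_type:
  assumes "a \<in> elts (parity_system \<Gamma>)" "b \<in> elts (parity_system \<Gamma>)" "pinc \<Gamma> a b"
    and "ptyp \<Gamma> a = ptyp \<Gamma> b"
  shows "a = b"
  using assms by (cases a; cases b) (auto simp: parity_elts)

lemma ptyp_in_types:
  assumes "a \<in> elts (parity_system \<Gamma>)"
  shows "ptyp \<Gamma> a \<in> types \<Gamma>"
  using assms types01 ty_in_types by (cases a) (auto simp: parity_elts)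

lemma parity_system_geometry: "incidence_geometry (parity_system \<Gamma>)"
  unfolding incidence_geometry_def incidence_system_def reflp_on_def symp_on_def
    parity_inc parity_ty parity_types
  by (intro conjI ballI allI impI image_subsetI; (elim conjE)?)
    (rule ptyp_in_types pinc_refl pinc_sym pinc_same_type parity_flag_extend; assumption)+

end

theorem theorem3p8:
  fixes \<Gamma> :: "('a, nat) inc_struct" and n :: nat
  assumes "n \<ge> 3"
    and "types \<Gamma> = {0..<n}"
    and "incidence_geometry \<Gamma>"
    and "residually_connected \<Gamma>"
    and "B1 \<Gamma>"
    and "B2 \<Gamma>"
    and "\<not> graph_bipartite (verts (truncation \<Gamma> {0, 1})) (adj (truncation \<Gamma> {0, 1}))"
  shows "incidence_geometry (parity_system \<Gamma>)"
proof -
  \<comment> \<open>From \<open>n \<ge> 3\<close> the types 0 and 1 occur, and the type set is a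
    finite initial segment.\<close>
  interpret graph_like_geometry \<Gamma>
    using assms by unfold_locales auto
  show ?thesis by (rule parity_system_geometry)
qed

end
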